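(* Let $G$ be a graph of order $n\geq 2$ and let $t\geq 2$. Then $\lambda(M^t(G))=2^t(n+1)-2$ if and only if $G\cong K_n$ or $\mathrm{diam}(G)=2$.
   Context: Graphs are finite, simple, undirected. $\mathrm{diam}(G)$ is the largest distance between two vertices of $G$ (infinite if $G$ is disconnected). An $L(2,1)$-labeling of $G$ is a map $f:V\to\{0,1,2,\dots\}$ with $|f(x)-f(y)|\ge 2$ if $d_G(x,y)=1$ and $|f(x)-f(y)|\ge1$ if $d_G(x,y)=2$; $\lambda(G)$ is the minimum over such $f$ of the largest label. For $V=\{v_1,\dots,v_n\}$, $M(G)$ has vertex set $V\cup\{v_1',\dots,v_n'\}\cup\{u\}$ and edge set $E\cup\{v_iv_j' : v_iv_j\in E\}\cup\{v_i'u: 1\le i\le n\}$; $M^0(G)=G$, $M^t(G)=M(M^{t-1}(G))$. *)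

theory Defs
  imports "Graph_Theory.Graph_Theory"
begin

text \<open>
  The distance is the library's shortest-walk length for unit arc weights; it is \<open>\<infinity>\<close> when
  no walk exists.
\<close>

definition gdist :: "'a pair_pre_digraph \<Rightarrow> 'a \<Rightarrow> 'a \<Rightarrow> ereal" where
  "gdist G u v = wf_digraph.\<mu> (with_proj G) (\<lambda>_. 1) u v"

lemma gdist_conv_length:
  assumes "pair_graph G"
  shows "gdist G u v =
    (INF p \<in> {p. pre_digraph.awalk (with_proj G) u p v}. ereal (real (length p)))"
proof -
  interpret pair_graph G by fact
  have "awalk_cost (\<lambda>_. 1) p = real (length p)" for p :: "('a \<times> 'a) list"
    by (induct p) auto
  then show ?thesis unfolding gdist_def \<mu>_def by simp
qed

definition diam :: "'a pair_pre_digraph \<Rightarrow> ereal" where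
  "diam G = (SUP u \<in> pverts G. SUP v \<in> pverts G. gdist G u v)"

definition L21_labeling :: "'a pair_pre_digraph \<Rightarrow> ('a \<Rightarrow> nat) \<Rightarrow> bool" where
  "L21_labeling G f \<longleftrightarrow>
     (\<forall>x \<in> pverts G. \<forall>y \<in> pverts G.
        (gdist G x y = 1 \<longrightarrow> \<bar>int (f x) - int (f y)\<bar> \<ge> 2) \<and>
        (gdist G x y = 2 \<longrightarrow> \<bar>int (f x) - int (f y)\<bar> \<ge> 1))"

definition L21_number :: "'a pair_pre_digraph \<Rightarrow> nat" where
  "L21_number G = (LEAST k. \<exists>f. L21_labeling G f \<and> k = Max (f ` pverts G))"

text \<open>
  Iterating the Mycielskian needs fresh vertices at each step within one type. One step turns each
  vertex \<open>v\<close> into \<open>Orig v\<close> (the vertex \<open>v\<close> itself) and \<open>Twin v\<close> (its copy \<open>v'\<close>), and adds \<open>Apex\<close>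
  (the vertex \<open>u\<close>); \<open>Base\<close> embeds the vertices of the graph one starts from. The constructors being
  injective with disjoint ranges, the three parts of the new vertex set are always disjoint.
\<close>

datatype 'a mvertex = Base 'a | Orig "'a mvertex" | Twin "'a mvertex" | Apex

definition mycielskian :: "'a mvertex pair_pre_digraph \<Rightarrow> 'a mvertex pair_pre_digraph" where
  "mycielskian G =
     \<lparr> pverts = Orig ` pverts G \<union> Twin ` pverts G \<union> {Apex},
       parcs = {(Orig x, Orig y) | x y. (x, y) \<in> parcs G}
             \<union> {(Orig x, Twin y) | x y. (x, y) \<in> parcs G}
             \<union> {(Twin x, Orig y) | x y. (x, y) \<in> parcs G}
             \<union> {(Twin x, Apex) | x. x \<in> pverts G}
             \<union> {(Apex, Twin x) | x. x \<in> pverts G} \<rparr>"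

primrec iter_mycielskian :: "nat \<Rightarrow> 'a pair_pre_digraph \<Rightarrow> 'a mvertex pair_pre_digraph" where
  "iter_mycielskian 0 G =
     \<lparr> pverts = Base ` pverts G, parcs = map_prod Base Base ` parcs G \<rparr>"
| "iter_mycielskian (Suc t) G = mycielskian (iter_mycielskian t G)"

lemma pair_graph_iff:
  "pair_graph G \<longleftrightarrow> finite (pverts G) \<and> parcs G \<subseteq> pverts G \<times> pverts G \<and> sym (parcs G) \<and> irrefl (parcs G)"
proof
  assume "pair_graph G"
  then interpret pair_graph G .
  show "finite (pverts G) \<and> parcs G \<subseteq> pverts G \<times> pverts G \<and> sym (parcs G) \<and> irrefl (parcs G)"
    using pair_finite_verts arc_fst_in_verts arc_snd_in_verts pair_sym_arcs pair_no_loops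
    by (fastforce simp: symmetric_def irrefl_def)
next
  assume *: "finite (pverts G) \<and> parcs G \<subseteq> pverts G \<times> pverts G \<and> sym (parcs G) \<and> irrefl (parcs G)"
  then have "finite (parcs G)"
    by (meson finite_SigmaI finite_subset)
  with * show "pair_graph G"
    by unfold_locales (auto simp: symmetric_def irrefl_def)
qed

lemma pair_graph_mycielskian:
  assumes "pair_graph G"
  shows "pair_graph (mycielskian G)"
  using assms unfolding pair_graph_iff
  by (auto simp: mycielskian_def sym_def irrefl_def)

lemma pair_graph_iter_mycielskian:
  assumes "pair_graph G"
  shows "pair_graph (iter_mycielskian t G)"
proof (induction t)
  case 0
  show ?case
    using assms unfolding pair_graph_iff by (fastforce simp: sym_def irrefl_def)
next
  case (Suc t)
  then show ?case by (simp add: pair_graph_mycielskian)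
qed

end

theory Submission
  imports Defs
begin

text \<open>
  The graph \<open>M\<^sup>t(G)\<close> has \<open>2\<^sup>t(n + 1) - 1\<close> vertices, so the value in question is its order minus one.
  For \<open>t \<ge> 2\<close> it is \<open>M(M(F))\<close> with \<open>F = M\<^sup>t\<^sup>-\<^sup>2(G)\<close>, and the complement of \<open>M(M(F))\<close> always has a
  Hamiltonian path; numbering the vertices along it gives the upper bound. If any two vertices of
  \<open>G\<close> are at distance at most two, this is inherited by \<open>M\<^sup>t(G)\<close>, all labels are distinct, and the
  bound is attained. Otherwise two vertices of \<open>F\<close> are at distance at least three, their copies in
  \<open>M(M(F))\<close> still are, and a Hamiltonian path of the complement can be chosen to end in the last
  apex followed by these two copies. As the apex is adjacent to neither, they can share the last
  label, which saves one.
\<close>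

section \<open>Short distances\<close>

text \<open>An infimum lies below \<open>c\<close> exactly when one of its members does, so strict
  bounds turn directly into short walks. Distances equal to 1 or 2 are therefore pinned down by
  pairs of strict bounds.\<close>

lemma gdist_less_iff:
  assumes "pair_graph G"
  shows "gdist G u v < c \<longleftrightarrow>
    (\<exists>p. pre_digraph.awalk (with_proj G) u p v \<and> ereal (real (length p)) < c)"
  using assms by (auto simp: gdist_conv_length INF_less_iff)

lemma gdist_le_length:
  assumes "pair_graph G" "pre_digraph.awalk (with_proj G) u p v"
  shows "gdist G u v \<le> ereal (real (length p))"
  using assms by (auto simp: gdist_conv_length intro: INF_lower)

lemma awalk_length_0_iff:
  assumes "pair_graph G"
  shows "pre_digraph.awalk (with_proj G) u [] v \<longleftrightarrow> u = v \<and> u \<in> pverts G"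
proof -
  interpret pair_graph G by fact
  show ?thesis by (auto simp: awalk_Nil_iff)
qed

lemma awalk_length_1_iff:
  assumes "pair_graph G"
  shows "pre_digraph.awalk (with_proj G) u [a] v \<longleftrightarrow> a = (u, v) \<and> (u, v) \<in> parcs G"
proof -
  interpret pair_graph G by fact
  show ?thesis by (cases a) (auto simp: awalk_Cons_iff awalk_Nil_iff dest: arc_snd_in_verts)
qed

lemma awalk_length_2_iff:
  assumes "pair_graph G"
  shows "pre_digraph.awalk (with_proj G) u [a, b] v \<longleftrightarrow>
    (\<exists>z. a = (u, z) \<and> b = (z, v) \<and> (u, z) \<in> parcs G \<and> (z, v) \<in> parcs G)"
proof -
  interpret pair_graph G by fact
  show ?thesis
    by (cases a; cases b) (auto simp: awalk_Cons_iff awalk_Nil_iff dest: arc_snd_in_verts)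
qed

lemma gdist_less_1_iff:
  assumes "pair_graph G"
  shows "gdist G u v < 1 \<longleftrightarrow> u = v \<and> u \<in> pverts G"
  using awalk_length_0_iff[OF assms] by (auto simp: gdist_less_iff[OF assms] one_ereal_def)

lemma gdist_less_2_iff:
  assumes "pair_graph G"
  shows "gdist G u v < 2 \<longleftrightarrow> u = v \<and> u \<in> pverts G \<or> (u, v) \<in> parcs G"
proof -
  have short: "ereal (real (length p)) < 2 \<longleftrightarrow> p = [] \<or> (\<exists>a. p = [a])" for p :: "('a \<times> 'a) list"
    by (cases p; cases "tl p") auto
  have "gdist G u v < 2 \<longleftrightarrow> pre_digraph.awalk (with_proj G) u [] v \<or>
      (\<exists>a. pre_digraph.awalk (with_proj G) u [a] v)"
    unfolding gdist_less_iff[OF assms] short by blast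
  then show ?thesis
    unfolding awalk_length_0_iff[OF assms] awalk_length_1_iff[OF assms] by blast
qed

text \<open>For \<open>u = v\<close> in a graph this says that \<open>u\<close> is not isolated; the
  trivial walk is not counted.\<close>

definition within_two :: "'a pair_pre_digraph \<Rightarrow> 'a \<Rightarrow> 'a \<Rightarrow> bool" where
  "within_two G u v \<longleftrightarrow> (u, v) \<in> parcs G \<or> (\<exists>z. (u, z) \<in> parcs G \<and> (z, v) \<in> parcs G)"

lemma within_two_in_pverts:
  assumes "pair_graph G" "within_two G u v"
  shows "u \<in> pverts G"
  using assms by (auto simp: within_two_def pair_graph_iff)

lemma gdist_less_3_iff:
  assumes "pair_graph G"
  shows "gdist G u v < 3 \<longleftrightarrow> u = v \<and> u \<in> pverts G \<or> within_two G u v"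
proof -
  have short: "ereal (real (length p)) < 3 \<longleftrightarrow> p = [] \<or> (\<exists>a. p = [a]) \<or> (\<exists>a b. p = [a, b])"
    for p :: "('a \<times> 'a) list"
    by (cases p; cases "tl p"; cases "tl (tl p)") auto
  have "gdist G u v < 3 \<longleftrightarrow> pre_digraph.awalk (with_proj G) u [] v \<or>
      (\<exists>a. pre_digraph.awalk (with_proj G) u [a] v) \<or>
      (\<exists>a b. pre_digraph.awalk (with_proj G) u [a, b] v)"
    unfolding gdist_less_iff[OF assms] short by blast
  then show ?thesis
    unfolding awalk_length_0_iff[OF assms] awalk_length_1_iff[OF assms]
      awalk_length_2_iff[OF assms] within_two_def by blast
qed

lemma gdist_eq_1_iff:
  assumes "pair_graph G"
  shows "gdist G u v = 1 \<longleftrightarrow> (u, v) \<in> parcs G"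
proof
  assume "gdist G u v = 1"
  then have "gdist G u v < 2" "\<not> gdist G u v < 1" by auto
  then show "(u, v) \<in> parcs G"
    using gdist_less_1_iff[OF assms] gdist_less_2_iff[OF assms] by blast
next
  assume uv: "(u, v) \<in> parcs G"
  then have "gdist G u v \<le> 1"
    using gdist_le_length[OF assms, of u "[(u, v)]" v] assms
    by (simp add: awalk_length_1_iff one_ereal_def)
  moreover have "\<not> gdist G u v < 1"
    using uv assms by (auto simp: gdist_less_1_iff pair_graph_iff irrefl_def)
  ultimately show "gdist G u v = 1" by auto
qed

lemma gdist_le_2:
  assumes "pair_graph G" "u = v \<and> u \<in> pverts G \<or> within_two G u v"
  shows "gdist G u v \<le> 2"
proof (cases "gdist G u v < 2")
  case False
  with assms(2) obtain z where "(u, z) \<in> parcs G" "(z, v) \<in> parcs G"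
    unfolding gdist_less_2_iff[OF assms(1)] within_two_def by blast
  then show ?thesis
    using gdist_le_length[OF assms(1), of u "[(u, z), (z, v)]" v] assms(1)
    by (simp add: awalk_length_2_iff)
qed simp

lemma gdist_eq_2_iff:
  assumes "pair_graph G"
  shows "gdist G u v = 2 \<longleftrightarrow> u \<noteq> v \<and> (u, v) \<notin> parcs G \<and> within_two G u v"
proof
  assume "gdist G u v = 2"
  then have "gdist G u v < 3" "\<not> gdist G u v < 2" by auto
  then show "u \<noteq> v \<and> (u, v) \<notin> parcs G \<and> within_two G u v"
    using gdist_less_2_iff[OF assms] gdist_less_3_iff[OF assms] within_two_in_pverts[OF assms]
    by blast
next
  assume uv: "u \<noteq> v \<and> (u, v) \<notin> parcs G \<and> within_two G u v"
  then have "gdist G u v \<le> 2" "\<not> gdist G u v < 2"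
    using gdist_le_2[OF assms] gdist_less_2_iff[OF assms] by blast+
  then show "gdist G u v = 2" by auto
qed

section \<open>Diameter at most two\<close>

lemma gdist_le_diam:
  assumes "u \<in> pverts G" "v \<in> pverts G"
  shows "gdist G u v \<le> diam G"
  unfolding diam_def using assms by (intro SUP_upper2[OF assms(1)] SUP_upper)

definition diam_le_two :: "'a pair_pre_digraph \<Rightarrow> bool" where
  "diam_le_two G \<longleftrightarrow> (\<forall>u \<in> pverts G. \<forall>v \<in> pverts G. u \<noteq> v \<longrightarrow> within_two G u v)"

text \<open>If the diameter is at most two but not two, no pair is at distance exactly two, so any
  two distinct vertices are adjacent.\<close>

lemma complete_or_diam_2_iff:
  assumes G: "pair_graph G" and n: "card (pverts G) = n"
  shows "complete_digraph n (with_proj G) \<or> diam G = 2 \<longleftrightarrow> diam_le_two G"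
proof
  assume "complete_digraph n (with_proj G) \<or> diam G = 2"
  then show "diam_le_two G"
  proof
    assume "complete_digraph n (with_proj G)"
    then show ?thesis
      by (auto simp: complete_digraph_pair_def diam_le_two_def within_two_def)
  next
    assume "diam G = 2"
    then have "gdist G u v \<le> 2" if "u \<in> pverts G" "v \<in> pverts G" for u v
      using that gdist_le_diam by metis
    moreover have "(2 :: ereal) < 3" by simp
    ultimately have "gdist G u v < 3" if "u \<in> pverts G" "v \<in> pverts G" for u v
      using that by (meson le_less_trans)
    then show ?thesis
      using gdist_less_3_iff[OF G] unfolding diam_le_two_def by blast
  qed
next
  assume D: "diam_le_two G"
  show "complete_digraph n (with_proj G) \<or> diam G = 2"
  proof (rule disjCI)
    assume "diam G \<noteq> 2"
    have "diam G \<le> 2"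
      unfolding diam_def using D
      by (intro SUP_least gdist_le_2[OF G]) (auto simp: diam_le_two_def)
    have "(u, v) \<in> parcs G" if "u \<in> pverts G" "v \<in> pverts G" "u \<noteq> v" for u v
    proof (rule ccontr)
      assume "(u, v) \<notin> parcs G"
      then have "gdist G u v = 2"
        using D that gdist_eq_2_iff[OF G] unfolding diam_le_two_def by blast
      then have "2 \<le> diam G"
        using that gdist_le_diam by metis
      then show False
        using \<open>diam G \<le> 2\<close> \<open>diam G \<noteq> 2\<close> by simp
    qed
    then show "complete_digraph n (with_proj G)"
      using G n by (auto simp: complete_digraph_pair_def pair_graph_iff irrefl_def)
  qed
qed

section \<open>Labelings\<close>

text \<open>Adjacent pairs may be included in the second condition, since a gap of two already makes
  labels distinct.\<close>

lemma L21_labeling_iff: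
  assumes "pair_graph G"
  shows "L21_labeling G f \<longleftrightarrow>
    (\<forall>(x, y) \<in> parcs G. \<bar>int (f x) - int (f y)\<bar> \<ge> 2) \<and>
    (\<forall>x \<in> pverts G. \<forall>y \<in> pverts G. x \<noteq> y \<and> within_two G x y \<longrightarrow> f x \<noteq> f y)"
  (is "_ \<longleftrightarrow> ?R")
proof
  assume L: "L21_labeling G f"
  have arc: "\<bar>int (f x) - int (f y)\<bar> \<ge> 2" if "(x, y) \<in> parcs G" for x y
    using L assms that unfolding L21_labeling_def
    by (auto simp: gdist_eq_1_iff pair_graph_iff)
  moreover have "f x \<noteq> f y"
    if "x \<in> pverts G" "y \<in> pverts G" "x \<noteq> y" "within_two G x y" for x y
  proof (cases "(x, y) \<in> parcs G")
    case False
    then show ?thesis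
      using L assms that gdist_eq_2_iff[OF assms]
      unfolding L21_labeling_def by fastforce
  qed (use arc in force)
  ultimately show ?R by blast
next
  assume ?R
  then show "L21_labeling G f"
    unfolding L21_labeling_def gdist_eq_1_iff[OF assms] gdist_eq_2_iff[OF assms] by fastforce
qed

lemma L21_number_le:
  assumes "L21_labeling G f" "finite (pverts G)" "pverts G \<noteq> {}" "\<And>x. x \<in> pverts G \<Longrightarrow> f x \<le> k"
  shows "L21_number G \<le> k"
proof -
  have "L21_number G \<le> Max (f ` pverts G)"
    unfolding L21_number_def using assms(1) by (intro Least_le) blast
  also have "\<dots> \<le> k"
    using assms by simp
  finally show ?thesis .
qed

text \<open>\<open>LEAST\<close> yields an attained value only once some labeling is known;
  \<open>f\<close> supplies it.\<close>

lemma L21_number_attained: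
  assumes "L21_labeling G f"
  obtains g where "L21_labeling G g" "L21_number G = Max (g ` pverts G)"
proof -
  have "\<exists>g. L21_labeling G g \<and> L21_number G = Max (g ` pverts G)"
    unfolding L21_number_def
    by (rule LeastI[where P = "\<lambda>k. \<exists>g. L21_labeling G g \<and> k = Max (g ` pverts G)"])
      (use assms in blast)
  then show thesis using that by blast
qed

lemma L21_number_ge_if_diam_le_two:
  assumes G: "pair_graph G" and D: "diam_le_two G" and f: "L21_labeling G f"
  shows "card (pverts G) - 1 \<le> L21_number G"
proof -
  obtain g where g: "L21_labeling G g" "L21_number G = Max (g ` pverts G)"
    using L21_number_attained[OF f] .
  have fin: "finite (pverts G)"
    using G by (simp add: pair_graph_iff)
  have "inj_on g (pverts G)"
    using g(1) D unfolding L21_labeling_iff[OF G] diam_le_two_def inj_on_def by blast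
  then have "card (pverts G) = card (g ` pverts G)"
    by (simp add: card_image)
  also have "\<dots> \<le> card {..Max (g ` pverts G)}"
    using fin by (intro card_mono) auto
  finally show ?thesis
    using g(2) by simp
qed

section \<open>Mycielskians\<close>

lemma pverts_mycielskian: "pverts (mycielskian G) = Orig ` pverts G \<union> Twin ` pverts G \<union> {Apex}"
  by (simp add: mycielskian_def)

lemma parcs_mycielskian_simps [simp]:
  "(Orig x, Orig y) \<in> parcs (mycielskian G) \<longleftrightarrow> (x, y) \<in> parcs G"
  "(Orig x, Twin y) \<in> parcs (mycielskian G) \<longleftrightarrow> (x, y) \<in> parcs G"
  "(Twin x, Orig y) \<in> parcs (mycielskian G) \<longleftrightarrow> (x, y) \<in> parcs G"
  "(Twin x, Twin y) \<notin> parcs (mycielskian G)"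
  "(Twin x, Apex) \<in> parcs (mycielskian G) \<longleftrightarrow> x \<in> pverts G"
  "(Apex, Twin x) \<in> parcs (mycielskian G) \<longleftrightarrow> x \<in> pverts G"
  "(Orig x, Apex) \<notin> parcs (mycielskian G)"
  "(Apex, Orig x) \<notin> parcs (mycielskian G)"
  "(Apex, Apex) \<notin> parcs (mycielskian G)"
  "(Base a, z) \<notin> parcs (mycielskian G)"
  "(z, Base a) \<notin> parcs (mycielskian G)"
  by (auto simp: mycielskian_def)

section \<open>Orders of iterated Mycielskians\<close>

lemma card_pverts_mycielskian:
  assumes "finite (pverts G)"
  shows "card (pverts (mycielskian G)) = 2 * card (pverts G) + 1"
proof -
  have "card (Orig ` pverts G \<union> Twin ` pverts G) = card (pverts G) + card (pverts G)"
    using assms by (subst card_Un_disjoint) (auto simp: card_image inj_on_def)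
  then show ?thesis
    using assms by (simp add: pverts_mycielskian card_insert_if image_iff)
qed

lemma card_pverts_iter_mycielskian:
  assumes "pair_graph G"
  shows "card (pverts (iter_mycielskian t G)) + 1 = 2 ^ t * (card (pverts G) + 1)"
proof (induction t)
  case 0
  show ?case by (simp add: card_image inj_on_def)
next
  case (Suc t)
  have "finite (pverts (iter_mycielskian t G))"
    using pair_graph_iter_mycielskian[OF assms] by (simp add: pair_graph_iff)
  with Suc show ?case
    by (simp add: card_pverts_mycielskian)
qed

text \<open>A common neighbour of two originals is an original or a twin, never \<open>Apex\<close>,
  and projects to a common neighbour in \<open>G\<close>. Hence a far pair stays far under
  iteration.\<close>

lemma within_two_mycielskian_Orig_iff:
  "within_two (mycielskian G) (Orig x) (Orig y) \<longleftrightarrow> within_two G x y"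
proof
  assume "within_two (mycielskian G) (Orig x) (Orig y)"
  moreover have "within_two G x y"
    if "(Orig x, z) \<in> parcs (mycielskian G)" "(z, Orig y) \<in> parcs (mycielskian G)" for z
    using that by (cases z) (auto simp: within_two_def)
  ultimately show "within_two G x y"
    by (auto simp: within_two_def)
next
  assume "within_two G x y"
  then show "within_two (mycielskian G) (Orig x) (Orig y)"
    unfolding within_two_def by (metis parcs_mycielskian_simps(1))
qed

lemma diam_le_two_no_isolated:
  assumes "pair_graph G" "diam_le_two G" "2 \<le> card (pverts G)" "x \<in> pverts G"
  obtains z where "z \<in> pverts G" "(x, z) \<in> parcs G" "(z, x) \<in> parcs G"
proof -
  have "\<not> pverts G \<subseteq> {x}"
    using assms(3) card_mono[of "{x}" "pverts G"] by auto
  then obtain y where "y \<in> pverts G" "y \<noteq> x" by blast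
  then have "within_two G x y"
    using assms by (auto simp: diam_le_two_def)
  then show thesis
    using that assms(1) unfolding within_two_def pair_graph_iff sym_def by blast
qed

text \<open>Two twins meet at \<open>Apex\<close>. A neighbour \<open>z\<close> of \<open>x\<close>
  links \<open>Orig x\<close> to \<open>Twin x\<close> via \<open>Orig z\<close> and to
  \<open>Apex\<close> via \<open>Twin z\<close>. It exists because there are two vertices; over a
  single vertex \<open>Orig x\<close> would be isolated.\<close>

lemma diam_le_two_mycielskian:
  assumes G: "pair_graph G" and D: "diam_le_two G" and n: "2 \<le> card (pverts G)"
  shows "diam_le_two (mycielskian G)"
proof -
  let ?M = "mycielskian G"
  have sym: "within_two ?M u v" if "within_two ?M v u" for u v
    using that pair_graph_mycielskian[OF G] unfolding within_two_def pair_graph_iff sym_def by blast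
  have OO: "within_two ?M (Orig x) (Orig y)" if "x \<in> pverts G" "y \<in> pverts G" "x \<noteq> y" for x y
    using D that by (simp add: within_two_mycielskian_Orig_iff diam_le_two_def)
  have OT: "within_two ?M (Orig x) (Twin y)" if xy: "x \<in> pverts G" "y \<in> pverts G" for x y
  proof (cases "x = y")
    case True
    obtain z where "(x, z) \<in> parcs G" "(z, x) \<in> parcs G"
      using diam_le_two_no_isolated[OF G D n xy(1)] .
    then show ?thesis
      unfolding within_two_def using True by (metis parcs_mycielskian_simps(1,2))
  next
    case False
    then have "within_two G x y"
      using D xy by (simp add: diam_le_two_def)
    then show ?thesis
      unfolding within_two_def by (metis parcs_mycielskian_simps(1,2))
  qed
  have TT: "within_two ?M (Twin x) (Twin y)" if "x \<in> pverts G" "y \<in> pverts G" for x y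
    unfolding within_two_def using that by (metis parcs_mycielskian_simps(5,6))
  have OA: "within_two ?M (Orig x) Apex" if x: "x \<in> pverts G" for x
  proof -
    obtain z where "z \<in> pverts G" "(x, z) \<in> parcs G"
      using diam_le_two_no_isolated[OF G D n x] .
    then show ?thesis
      unfolding within_two_def by (metis parcs_mycielskian_simps(2,5))
  qed
  have TA: "within_two ?M (Twin x) Apex" if "x \<in> pverts G" for x
    using that by (simp add: within_two_def)
  show ?thesis
    unfolding diam_le_two_def pverts_mycielskian
    by (auto intro: OO OT TT OA TA sym)
qed

lemma diam_le_two_iter_mycielskian:
  assumes G: "pair_graph G" and D: "diam_le_two G" and n: "2 \<le> card (pverts G)"
  shows "diam_le_two (iter_mycielskian t G)"
proof (induction t)
  case 0
  have "within_two (iter_mycielskian 0 G) (Base u) (Base v)" if "within_two G u v" for u v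
    using that by (force simp: within_two_def)
  then show ?case
    using D by (auto simp: diam_le_two_def)
next
  case (Suc t)
  \<comment> \<open>The factors 1 and 3 bound \<open>2 ^ t\<close> and
    \<open>card (pverts G) + 1\<close> from below.\<close>
  have "1 * 3 \<le> card (pverts (iter_mycielskian t G)) + 1"
    unfolding card_pverts_iter_mycielskian[OF G] using n by (intro mult_le_mono) auto
  then have "2 \<le> card (pverts (iter_mycielskian t G))"
    by simp
  with Suc show ?case
    by (simp add: diam_le_two_mycielskian pair_graph_iter_mycielskian G)
qed

lemma not_diam_le_two_iter_mycielskian:
  assumes "\<not> diam_le_two G"
  shows "\<not> diam_le_two (iter_mycielskian t G)"
proof (induction t)
  case 0
  have "within_two G u v" if "within_two (iter_mycielskian 0 G) (Base u) (Base v)" for u v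
    using that by (auto simp: within_two_def)
  then show ?case
    using assms by (auto simp: diam_le_two_def)
next
  case (Suc t)
  then obtain x y where
    "x \<in> pverts (iter_mycielskian t G)" "y \<in> pverts (iter_mycielskian t G)" "x \<noteq> y"
    "\<not> within_two (iter_mycielskian t G) x y"
    by (auto simp: diam_le_two_def)
  then have "\<exists>u \<in> pverts (iter_mycielskian (Suc t) G). \<exists>v \<in> pverts (iter_mycielskian (Suc t) G).
    u \<noteq> v \<and> \<not> within_two (iter_mycielskian (Suc t) G) u v"
    by (intro bexI[of _ "Orig x"] bexI[of _ "Orig y"])
      (auto simp: within_two_mycielskian_Orig_iff pverts_mycielskian)
  then show ?case
    by (auto simp: diam_le_two_def)
qed

section \<open>Labelings of twofold Mycielskians\<close>

text \<open>
  Positions on the Hamiltonian path of the complement of \<open>M(M(F))\<close> that runs, for each vertex \<open>v\<close>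
  of \<open>F\<close>, through \<open>Twin (Orig v)\<close>, \<open>Orig (Orig v)\<close>, \<open>Orig (Twin v)\<close>, \<open>Twin (Twin v)\<close>, and ends with
  \<open>Twin Apex\<close>, \<open>Orig Apex\<close>, \<open>Apex\<close>; here \<open>e\<close> enumerates the \<open>m\<close> vertices of \<open>F\<close>.
\<close>

fun path_label :: "('a mvertex \<Rightarrow> nat) \<Rightarrow> nat \<Rightarrow> 'a mvertex \<Rightarrow> nat" where
  "path_label e m (Twin (Orig v)) = 4 * e v"
| "path_label e m (Orig (Orig v)) = 4 * e v + 1"
| "path_label e m (Orig (Twin v)) = 4 * e v + 2"
| "path_label e m (Twin (Twin v)) = 4 * e v + 3"
| "path_label e m (Twin Apex) = 4 * m"
| "path_label e m (Orig Apex) = 4 * m + 1"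
| "path_label e m Apex = 4 * m + 2"
| "path_label e m _ = 0"

text \<open>Positions are distinct, and consecutive vertices are non-adjacent: inside a block an arc
  would need a loop, between blocks two twins meet, and \<open>Orig Apex\<close> is adjacent neither
  to \<open>Twin Apex\<close> nor to \<open>Apex\<close>.\<close>

lemma path_labeling:
  assumes F: "pair_graph F" and e: "bij_betw e (pverts F) {..<m}"
  shows "L21_labeling (mycielskian (mycielskian F)) (path_label e m)"
proof -
  have bound: "e v < m" if "v \<in> pverts F" for v
    using e that by (auto simp: bij_betw_def)
  have inj: "e v = e w \<longleftrightarrow> v = w" if "v \<in> pverts F" "w \<in> pverts F" for v w
    using e that by (auto simp: bij_betw_def inj_on_def)
  have arc: "v \<in> pverts F" "w \<in> pverts F" "e v < m" "e w < m" "e v \<noteq> e w"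
    if "(v, w) \<in> parcs F" for v w
  proof -
    show vw: "v \<in> pverts F" "w \<in> pverts F"
      using F that by (auto simp: pair_graph_iff)
    then show "e v < m" "e w < m" "e v \<noteq> e w"
      using F that by (auto simp: bound inj pair_graph_iff irrefl_def)
  qed
  let ?K = "mycielskian (mycielskian F)" and ?f = "path_label e m"
  have "\<bar>int (?f x) - int (?f y)\<bar> \<ge> 2" if "(x, y) \<in> parcs ?K" for x y
    using that by (auto simp: mycielskian_def dest!: arc bound)
  moreover have "?f x \<noteq> ?f y" if "x \<in> pverts ?K" "y \<in> pverts ?K" "x \<noteq> y" for x y
    using that by (auto simp: pverts_mycielskian inj dest: bound) presburger+
  ultimately show ?thesis
    using F by (auto simp: L21_labeling_iff pair_graph_mycielskian)
qed

text \<open>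
  A variant in which the copies of \<open>a\<close> and \<open>b\<close> share the label after that of the last apex; \<open>e\<close> now
  enumerates the \<open>m\<close> vertices other than \<open>a\<close> and \<open>b\<close>.
\<close>

fun merged_label :: "'a mvertex \<Rightarrow> 'a mvertex \<Rightarrow> ('a mvertex \<Rightarrow> nat) \<Rightarrow> nat \<Rightarrow> 'a mvertex \<Rightarrow> nat"
where
  "merged_label a b e m (Twin (Orig v)) = (if v = a then 0 else if v = b then 1 else 4 * e v + 6)"
| "merged_label a b e m (Orig (Orig v)) = (if v = a \<or> v = b then 4 * m + 9 else 4 * e v + 7)"
| "merged_label a b e m (Orig (Twin v)) = (if v = a then 3 else if v = b then 4 else 4 * e v + 8)"
| "merged_label a b e m (Twin (Twin v)) = (if v = a then 2 else if v = b then 5 else 4 * e v + 9)"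
| "merged_label a b e m (Twin Apex) = 4 * m + 6"
| "merged_label a b e m (Orig Apex) = 4 * m + 7"
| "merged_label a b e m Apex = 4 * m + 8"
| "merged_label a b e m _ = 0"

text \<open>The labels 0 to 5 go to the other copies of \<open>a\<close> and \<open>b\<close>,
  ordered so that neighbours in the list are non-adjacent; the usual blocks follow, shifted by 6.
  The shared label \<open>4 * m + 9\<close> is allowed because the two copies are neither adjacent
  nor joined by a common neighbour.\<close>

lemma merged_labeling:
  assumes F: "pair_graph F" and e: "bij_betw e (pverts F - {a, b}) {..<m}"
    and ab: "a \<in> pverts F" "b \<in> pverts F" "a \<noteq> b" "\<not> within_two F a b"
  shows "L21_labeling (mycielskian (mycielskian F)) (merged_label a b e m)"
proof -
  have bound: "v = a \<or> v = b \<or> e v < m" if "v \<in> pverts F" for v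
    using e that by (auto simp: bij_betw_def)
  have inj: "e v = e w \<longleftrightarrow> v = w"
    if "v \<in> pverts F" "w \<in> pverts F" "v \<noteq> a" "v \<noteq> b" "w \<noteq> a" "w \<noteq> b" for v w
    using e that by (auto simp: bij_betw_def inj_on_def)
  have nadj: "(a, b) \<notin> parcs F" "(b, a) \<notin> parcs F"
    using ab F by (auto simp: within_two_def pair_graph_iff sym_def)
  \<comment> \<open>As \<open>a\<close> and \<open>b\<close> are not adjacent, an arc has at most
    one end among them; the other end lies in the range of the enumeration \<open>e\<close>.\<close>
  have arc: "v = a \<and> w \<noteq> a \<and> w \<noteq> b \<and> e w < m \<or> v = b \<and> w \<noteq> a \<and> w \<noteq> b \<and> e w < m \<or>
      w = a \<and> v \<noteq> a \<and> v \<noteq> b \<and> e v < m \<or> w = b \<and> v \<noteq> a \<and> v \<noteq> b \<and> e v < m \<or>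
      v \<noteq> a \<and> v \<noteq> b \<and> w \<noteq> a \<and> w \<noteq> b \<and> e v < m \<and> e w < m \<and> e v \<noteq> e w"
    if vw: "(v, w) \<in> parcs F" for v w
  proof -
    have "v \<in> pverts F" "w \<in> pverts F" "v \<noteq> w"
      using F vw by (auto simp: pair_graph_iff irrefl_def)
    then show ?thesis
      using bound[of v] bound[of w] inj[of v w] nadj vw by metis
  qed
  let ?K = "mycielskian (mycielskian F)" and ?f = "merged_label a b e m"
  have far: "\<not> within_two ?K (Orig (Orig a)) (Orig (Orig b))"
    "\<not> within_two ?K (Orig (Orig b)) (Orig (Orig a))"
    using ab(4) F unfolding within_two_mycielskian_Orig_iff
    by (auto simp: within_two_def pair_graph_iff sym_def)
  have "\<bar>int (?f x) - int (?f y)\<bar> \<ge> 2" if "(x, y) \<in> parcs ?K" for x y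
    using that ab(3) by (auto simp: mycielskian_def dest!: arc bound)
  moreover have inj_f: "inj_on ?f (pverts ?K - {Orig (Orig b)})"
  proof -
    define d where "d = inv_into (pverts F - {a, b}) e"
    have d: "d (e v) = v" if "v \<in> pverts F" "v \<noteq> a" "v \<noteq> b" for v
      unfolding d_def using e that by (intro inv_into_f_f) (auto simp: bij_betw_def)
    \<comment> \<open>Injectivity is shown by an explicit left inverse. The six initial and four
      final labels are tabulated; otherwise the residue mod 4 gives the kind of copy and the
      quotient gives the vertex. The truncated \<open>k - 6\<close> is harmless, since smaller
      \<open>k\<close> are in the table.\<close>
    define decode where "decode k =
      (if k = 0 then Twin (Orig a) else if k = 1 then Twin (Orig b)
       else if k = 2 then Twin (Twin a) else if k = 3 then Orig (Twin a)
       else if k = 4 then Orig (Twin b) else if k = 5 then Twin (Twin b)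
       else if k = 4 * m + 6 then Twin Apex else if k = 4 * m + 7 then Orig Apex
       else if k = 4 * m + 8 then Apex else if k = 4 * m + 9 then Orig (Orig a)
       else let v = d ((k - 6) div 4) in
         if k mod 4 = 2 then Twin (Orig v) else if k mod 4 = 3 then Orig (Orig v)
         else if k mod 4 = 0 then Orig (Twin v) else Twin (Twin v))" for k
    have decode_other: "decode (4 * e v + 6) = Twin (Orig v)" "decode (4 * e v + 7) = Orig (Orig v)"
      "decode (4 * e v + 8) = Orig (Twin v)" "decode (4 * e v + 9) = Twin (Twin v)"
      if v: "v \<in> pverts F" "v \<noteq> a" "v \<noteq> b" for v
    proof -
      have "(4 * e v + 6) mod 4 = 2" "(4 * e v + 7) mod 4 = 3" "(4 * e v + 8) mod 4 = 0"
        "(4 * e v + 9) mod 4 = 1" "(4 * e v + 6 - 6) div 4 = e v" "(4 * e v + 7 - 6) div 4 = e v"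
        "(4 * e v + 8 - 6) div 4 = e v" "(4 * e v + 9 - 6) div 4 = e v"
        by presburger+
      \<comment> \<open>This keeps block labels at most \<open>4 * m + 5\<close>, below the
        tabulated final ones.\<close>
      moreover have "e v < m"
        using bound v by blast
      ultimately show "decode (4 * e v + 6) = Twin (Orig v)" "decode (4 * e v + 7) = Orig (Orig v)"
        "decode (4 * e v + 8) = Orig (Twin v)" "decode (4 * e v + 9) = Twin (Twin v)"
        unfolding decode_def Let_def using d[OF v] by simp_all
    qed
    have "decode (?f x) = x" if x: "x \<in> pverts ?K - {Orig (Orig b)}" for x
    proof -
      consider (Apex) "x \<in> {Twin Apex, Orig Apex, Apex}"
        | (v) v where "v \<in> pverts F"
          "x \<in> {Twin (Orig v), Orig (Orig v), Orig (Twin v), Twin (Twin v)}"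
        using x by (auto simp: pverts_mycielskian)
      then show ?thesis
      proof cases
        case Apex
        then show ?thesis by (auto simp: decode_def)
      next
        case v
        then show ?thesis
        proof (cases "v = a \<or> v = b")
          case True
          then show ?thesis
            using v(2) x ab(3) by (auto simp: decode_def)
        next
          case False
          then show ?thesis
            using v decode_other[OF v(1)] by (auto simp del: One_nat_def)
        qed
      qed
    qed
    then show ?thesis
      by (rule inj_on_inverseI)
  qed
  moreover have "?f x \<noteq> ?f y"
    if xy: "x \<in> pverts ?K" "y \<in> pverts ?K" "x \<noteq> y" "within_two ?K x y" for x y
  proof -
    \<comment> \<open>If one vertex is \<open>Orig (Orig b)\<close>, it is replaced by
      \<open>Orig (Orig a)\<close>, which has the same label; by \<open>far\<close> the other vertex
      is neither of these two.\<close>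
    have a: "Orig (Orig a) \<in> pverts ?K - {Orig (Orig b)}" "?f (Orig (Orig b)) = ?f (Orig (Orig a))"
      using ab by (simp_all add: pverts_mycielskian)
    consider "x = Orig (Orig b)" "y \<noteq> Orig (Orig a)" "y \<noteq> Orig (Orig b)"
      | "y = Orig (Orig b)" "x \<noteq> Orig (Orig a)" "x \<noteq> Orig (Orig b)"
      | "x \<noteq> Orig (Orig b)" "y \<noteq> Orig (Orig b)"
      using xy far by blast
    then show ?thesis
    proof cases
      case 1
      then show ?thesis
        using inj_on_eq_iff[OF inj_f a(1), of y] a(2) xy(2) by auto
    next
      case 2
      then show ?thesis
        using inj_on_eq_iff[OF inj_f a(1), of x] a(2) xy(1) by auto
    next
      case 3
      then show ?thesis
        using inj_on_eq_iff[OF inj_f, of x y] xy by blast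
    qed
  qed
  ultimately show ?thesis
    using F by (auto simp: L21_labeling_iff pair_graph_mycielskian)
qed

lemma L21_number_mycielskian_mycielskian_less:
  assumes F: "pair_graph F" and D: "\<not> diam_le_two F"
  shows "L21_number (mycielskian (mycielskian F)) < card (pverts (mycielskian (mycielskian F))) - 1"
proof -
  let ?K = "mycielskian (mycielskian F)"
  obtain a b where ab: "a \<in> pverts F" "b \<in> pverts F" "a \<noteq> b" "\<not> within_two F a b"
    using D by (auto simp: diam_le_two_def)
  have fin: "finite (pverts F)"
    using F by (simp add: pair_graph_iff)
  then have finM: "finite (pverts (mycielskian F))"
    by (simp add: pverts_mycielskian)
  define m where "m = card (pverts F - {a, b})"
  obtain e where e: "bij_betw e (pverts F - {a, b}) {..<m}"
    using ex_bij_betw_finite_nat[of "pverts F - {a, b}"] fin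
    by (auto simp: m_def atLeast0LessThan)
  have "card (pverts F) = m + 2"
    using ab fin card_mono[of "pverts F" "{a, b}"] by (simp add: m_def card_Diff_subset)
  \<comment> \<open>The order is 4(m + 2) + 3, so the largest label \<open>4 * m + 9\<close> is the
    order minus two.\<close>
  then have card: "card (pverts ?K) = 4 * m + 11"
    using fin F by (simp add: card_pverts_mycielskian finM)
  have "v = a \<or> v = b \<or> e v < m" if "v \<in> pverts F" for v
    using e that by (auto simp: bij_betw_def)
  then have "merged_label a b e m x \<le> 4 * m + 9" if "x \<in> pverts ?K" for x
    using that by (fastforce simp: pverts_mycielskian)
  then have "L21_number ?K \<le> 4 * m + 9"
    using finM by (intro L21_number_le[OF merged_labeling[OF F e ab]]) (simp_all add: pverts_mycielskian)
  then show ?thesis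
    using card by simp
qed

lemma L21_number_mycielskian_mycielskian_eq:
  assumes F: "pair_graph F" and D: "diam_le_two (mycielskian (mycielskian F))"
  shows "L21_number (mycielskian (mycielskian F)) = card (pverts (mycielskian (mycielskian F))) - 1"
proof (rule antisym)
  let ?K = "mycielskian (mycielskian F)"
  have fin: "finite (pverts F)"
    using F by (simp add: pair_graph_iff)
  then have finM: "finite (pverts (mycielskian F))"
    by (simp add: pverts_mycielskian)
  define m where "m = card (pverts F)"
  obtain e where e: "bij_betw e (pverts F) {..<m}"
    using ex_bij_betw_finite_nat[OF fin] by (auto simp: m_def atLeast0LessThan)
  have card: "card (pverts ?K) = 4 * m + 3"
    using fin F by (simp add: m_def card_pverts_mycielskian finM)
  have "e v < m" if "v \<in> pverts F" for v
    using e that by (auto simp: bij_betw_def)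
  then have "path_label e m x \<le> 4 * m + 2" if "x \<in> pverts ?K" for x
    using that by (fastforce simp: pverts_mycielskian)
  then have "L21_number ?K \<le> 4 * m + 2"
    using finM by (intro L21_number_le[OF path_labeling[OF F e]]) (simp_all add: pverts_mycielskian)
  then show "L21_number ?K \<le> card (pverts ?K) - 1"
    using card by simp
  \<comment> \<open>The path labeling is used again, now as the labeling that makes the minimum
    attained.\<close>
  show "card (pverts ?K) - 1 \<le> L21_number ?K"
    using L21_number_ge_if_diam_le_two[OF _ D path_labeling[OF F e]] F
    by (simp add: pair_graph_mycielskian)
qed

theorem theorem4p3:
  fixes G :: "'a pair_pre_digraph" and n t :: nat
  assumes "pair_graph G" and "card (pverts G) = n" and "n \<ge> 2" and "t \<ge> 2"
  shows "L21_number (iter_mycielskian t G) = 2 ^ t * (n + 1) - 2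
     \<longleftrightarrow> complete_digraph n (with_proj G) \<or> diam G = 2"
proof -
  define F where "F = iter_mycielskian (t - 2) G"
  have F: "pair_graph F"
    unfolding F_def using assms(1) by (rule pair_graph_iter_mycielskian)
  have "t = Suc (Suc (t - 2))"
    using assms(4) by simp
  then have K: "iter_mycielskian t G = mycielskian (mycielskian F)"
    unfolding F_def by (metis iter_mycielskian.simps(2))
  have card: "2 ^ t * (n + 1) - 2 = card (pverts (iter_mycielskian t G)) - 1"
    using card_pverts_iter_mycielskian[OF assms(1), of t] assms(2) by simp
  have "L21_number (iter_mycielskian t G) = 2 ^ t * (n + 1) - 2 \<longleftrightarrow> diam_le_two G"
  proof
    assume "diam_le_two G"
    then have "diam_le_two (iter_mycielskian t G)"
      using assms by (simp add: diam_le_two_iter_mycielskian)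
    then show "L21_number (iter_mycielskian t G) = 2 ^ t * (n + 1) - 2"
      using L21_number_mycielskian_mycielskian_eq[OF F] unfolding card K by simp
  next
    assume eq: "L21_number (iter_mycielskian t G) = 2 ^ t * (n + 1) - 2"
    show "diam_le_two G"
    proof (rule ccontr)
      assume "\<not> diam_le_two G"
      \<comment> \<open>The far pair is needed in \<open>F\<close> itself, two levels below, because
        the merged labeling is built from it.\<close>
      then have "\<not> diam_le_two F"
        unfolding F_def by (rule not_diam_le_two_iter_mycielskian)
      then show False
        using L21_number_mycielskian_mycielskian_less[OF F] eq unfolding card K by simp
    qed
  qed
  then show ?thesis
    using complete_or_diam_2_iff[OF assms(1,2)] by simp
qed

end
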